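(* Let $ABCD$ be a rectangle and let $P$ be a point of the rectangle such that the angle $\alpha=\angle(CBP)$ with vertex $B$ satisfies $0^\circ<\alpha<90^\circ$. Let $\overleftrightarrow{EF}$ be a parallel to $\overleftrightarrow{BC}$, different from $\overleftrightarrow{BC}$, with $E\in\overline{AB}$ and $F\in\overline{CD}$, and let $\overleftrightarrow{GH}$ be the mid-parallel of $\overleftrightarrow{BC}$ and $\overleftrightarrow{EF}$, with $G\in\overline{AB}$ and $H\in\overline{CD}$. Suppose a fold along a line $t$ (i.e. the reflection in $t$) maps $B$ to a point $B'\in\overline{GH}$ and simultaneously maps $E$ to a point $E'\in\overline{BP}$, and let $I$ be the intersection point of $t$ with $\overleftrightarrow{GH}$. Then the rays $\overrightarrow{BI}$ and $\overrightarrow{BB'}$ trisect the angle $\alpha$.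
   Context: The vertices $A,B,C,D$ of the rectangle are listed in cyclic order. $\overline{XY}$ denotes the segment, $\overleftrightarrow{XY}$ the line through $X$ and $Y$, and $\overrightarrow{XY}$ the ray from $X$ through $Y$. $\angle(XYZ)$ is the angle with vertex $Y$ and sides through $X$ and $Z$. The mid-parallel of two parallel lines is the line parallel to and equidistant from both, lying between them. *)

theory Defs
  imports "HOL-Analysis.Analysis"
begin

type_synonym plane = "real ^ 2"

abbreviation line_through :: "plane \<Rightarrow> plane \<Rightarrow> plane set" where
  "line_through X Y \<equiv> affine hull {X, Y}"

definition is_line :: "plane set \<Rightarrow> bool" where
  "is_line l \<longleftrightarrow> (\<exists>X Y. X \<noteq> Y \<and> l = line_through X Y)"

definition ray :: "plane \<Rightarrow> plane \<Rightarrow> plane set" where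
  "ray X Y = {X + s *\<^sub>R (Y - X) | s. 0 \<le> s}"

(* Unoriented angle, in radians, with vertex Y. If X = Y or Z = Y the value is
   the junk value arccos 0 = pi / 2. *)
definition angle :: "plane \<Rightarrow> plane \<Rightarrow> plane \<Rightarrow> real" where
  "angle X Y Z = arccos (((X - Y) \<bullet> (Z - Y)) / (norm (X - Y) * norm (Z - Y)))"

definition rectangle :: "plane \<Rightarrow> plane \<Rightarrow> plane \<Rightarrow> plane \<Rightarrow> bool" where
  "rectangle A B C D \<longleftrightarrow>
     A \<noteq> B \<and> B \<noteq> C \<and> C \<noteq> D \<and> D \<noteq> A \<and>
     angle D A B = pi / 2 \<and> angle A B C = pi / 2 \<and>
     angle B C D = pi / 2 \<and> angle C D A = pi / 2"

(* For parallel lines k and l, convex hull (k \<union> l) is the closed strip they bound. *)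
definition mid_parallel :: "plane set \<Rightarrow> plane set \<Rightarrow> plane set \<Rightarrow> bool" where
  "mid_parallel m k l \<longleftrightarrow>
     affine_parallel m k \<and> affine_parallel m l \<and>
     (\<forall>X\<in>m. infdist X k = infdist X l) \<and> m \<subseteq> convex hull (k \<union> l)"

(* closest_point t X is the foot of the perpendicular from X to the line t. *)
definition reflect_in :: "plane set \<Rightarrow> plane \<Rightarrow> plane" where
  "reflect_in t X = 2 *\<^sub>R closest_point t X - X"

(* The rays r and s from Y cut the angle XYZ into three equal parts, r being the one
   next to the side through X. Angles are unoriented, but the three parts add up to
   angle X Y Z, so for angle X Y Z < pi both rays lie inside the angle. *)
definition trisect_angle ::
  "plane set \<Rightarrow> plane set \<Rightarrow> plane \<Rightarrow> plane \<Rightarrow> plane \<Rightarrow> bool" where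
  "trisect_angle r s X Y Z \<longleftrightarrow>
     (\<exists>U V. U \<noteq> Y \<and> V \<noteq> Y \<and> r = ray Y U \<and> s = ray Y V \<and>
        angle X Y U = angle X Y Z / 3 \<and>
        angle U Y V = angle X Y Z / 3 \<and>
        angle V Y Z = angle X Y Z / 3)"

end

theory Submission
  imports Defs
begin

text \<open>
  Put B at the origin of an orthonormal frame with the first axis along BC, and read the plane as
  the complex numbers. Then B' = z has imaginary part h > 0 and E = 2hi. Reflecting E in the
  perpendicular bisector of 0 and z gives z^3 / |z|^2, so E' has argument 3 * arg z; since E' lies
  on the ray BP, this argument is \<alpha>. The point I has imaginary part h and is equidistant from 0
  and z, which makes it a positive multiple of z^2, of argument 2 * arg z.
\<close>

section \<open>Orthogonal projection onto a line and reflection in it\<close>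

lemma closest_point_affine_orthogonal:
  fixes S :: "'a::euclidean_space set"
  assumes "affine S" and "X \<in> S"
  shows "(Y - closest_point S Y) \<bullet> (X - closest_point S Y) = 0"
proof -
  let ?c = "closest_point S Y"
  have cl: "closed S" and cv: "convex S"
    using assms(1) by (auto simp: affine_closed affine_imp_convex)
  have c: "?c \<in> S" using closest_point_in_set[OF cl] assms(2) by blast
  \<comment> \<open>The mirror image of \<open>X\<close> through the foot \<open>?c\<close> also
    lies in \<open>S\<close>, so the obtuse-angle inequality of convex projection holds for opposite
    directions and becomes an equality.\<close>
  have "2 *\<^sub>R ?c + (-1) *\<^sub>R X \<in> S"
    using assms c by (intro mem_affine) auto
  then have "(Y - ?c) \<bullet> ((2 *\<^sub>R ?c + (-1) *\<^sub>R X) - ?c) \<le> 0"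
    by (rule closest_point_dot[OF cv cl])
  moreover have "(2 *\<^sub>R ?c + (-1) *\<^sub>R X) - ?c = - (X - ?c)"
    by (simp add: algebra_simps scaleR_2)
  moreover have "(Y - ?c) \<bullet> (X - ?c) \<le> 0"
    using closest_point_dot[OF cv cl assms(2)] .
  ultimately show ?thesis by (simp only: inner_minus_right)
qed

lemma affine_is_line: "is_line t \<Longrightarrow> affine t"
  by (auto simp: is_line_def)

text \<open>Seen from the foot of the perpendicular, \<open>X\<close> and \<open>Y\<close> lie in
  orthogonal directions, so the sum and the difference of these two vectors have equal norm.\<close>

lemma dist_reflect_in_eq:
  assumes "is_line t" and "X \<in> t"
  shows "dist X (reflect_in t Y) = dist X Y"
proof -
  let ?c = "closest_point t Y"
  have "(Y - ?c) \<bullet> (X - ?c) = 0"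
    using assms by (intro closest_point_affine_orthogonal affine_is_line)
  then have "norm ((X - ?c) + (Y - ?c)) = norm ((X - ?c) - (Y - ?c))"
    unfolding norm_eq
    by (simp only: inner_add_left inner_add_right inner_diff_left inner_diff_right inner_commute)
  moreover have "X - reflect_in t Y = (X - ?c) + (Y - ?c)" "X - Y = (X - ?c) - (Y - ?c)"
    by (simp_all add: reflect_in_def scaleR_2)
  ultimately show ?thesis by (simp only: dist_norm)
qed

lemma orthogonal_same_imp_parallel:
  fixes d m n :: plane
  assumes "d \<noteq> 0" and "m \<bullet> d = 0" and "n \<bullet> d = 0" and "n \<noteq> 0"
  shows "\<exists>k. m = k *\<^sub>R n"
proof -
  have m: "m $ 1 * d $ 1 + m $ 2 * d $ 2 = 0" and n: "n $ 1 * d $ 1 + n $ 2 * d $ 2 = 0"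
    using assms by (simp_all add: inner_vec_def UNIV_2)
  have d: "d $ 1 \<noteq> 0 \<or> d $ 2 \<noteq> 0" and n0: "n $ 1 \<noteq> 0 \<or> n $ 2 \<noteq> 0"
    using assms by (auto simp: vec_eq_iff forall_2)
  \<comment> \<open>Elimination in the two orthogonality relations: each coordinate of
    \<open>d\<close> annihilates the determinant of \<open>m\<close> and \<open>n\<close>, and one
    of these coordinates is nonzero.\<close>
  have "d $ 1 * (m $ 1 * n $ 2 - m $ 2 * n $ 1) = 0" "d $ 2 * (m $ 1 * n $ 2 - m $ 2 * n $ 1) = 0"
    using m n by algebra+
  then have det: "m $ 1 * n $ 2 = m $ 2 * n $ 1" using d by auto
  show ?thesis
  proof (cases "n $ 1 = 0")
    case True
    then show ?thesis using n0 det
      by (intro exI[of _ "m $ 2 / n $ 2"]) (auto simp: vec_eq_iff forall_2)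
  next
    case False
    then show ?thesis using det
      by (intro exI[of _ "m $ 1 / n $ 1"]) (auto simp: vec_eq_iff forall_2 field_simps)
  qed
qed

text \<open>A single moved point fixes the reflection, because the mirror is the perpendicular
  bisector of \<open>Y\<close> and \<open>Y'\<close>. Images of other points can thus be computed
  without coordinates for \<open>t\<close>; the coefficient of \<open>n\<close> is twice the
  component along \<open>n\<close> of \<open>X\<close> minus the midpoint.\<close>

lemma reflect_in_from_image:
  assumes t: "is_line t" and Y': "Y' = reflect_in t Y" "Y' \<noteq> Y"
  defines "n \<equiv> Y' - Y"
  shows "reflect_in t X = X - (((2 *\<^sub>R X - Y - Y') \<bullet> n) / (n \<bullet> n)) *\<^sub>R n"
proof -
  obtain P Q where PQ: "P \<noteq> Q" "t = line_through P Q" using t by (auto simp: is_line_def)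
  have P: "P \<in> t" and Q: "Q \<in> t" using PQ by (simp_all add: hull_inc)
  let ?d = "Q - P" and ?c = "closest_point t X" and ?m = "closest_point t Y"
  have perp: "(Z - closest_point t Z) \<bullet> ?d = 0" for Z
    using closest_point_affine_orthogonal[OF affine_is_line[OF t] P, of Z]
      closest_point_affine_orthogonal[OF affine_is_line[OF t] Q, of Z]
    by (simp add: inner_diff_right)
  have ct: "?c \<in> t" using P t
    by (intro closest_point_in_set) (auto simp: affine_closed affine_is_line)
  have n: "n = - 2 *\<^sub>R (Y - ?m)"
    by (simp add: n_def Y' reflect_in_def algebra_simps scaleR_2)
  have n0: "n \<noteq> 0" using Y' by (simp add: n_def)
  have "n \<bullet> ?d = 0" using perp[of Y] by (simp add: n)
  then obtain k where k: "X - ?c = k *\<^sub>R n"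
    using orthogonal_same_imp_parallel[of ?d "X - ?c" n] perp[of X] n0 PQ by auto
  have "(?c - ?m) \<bullet> n = 0"
    using closest_point_affine_orthogonal[OF affine_is_line[OF t] ct, of Y] by (simp add: n inner_commute)
  \<comment> \<open>The vector is split at the foot of \<open>X\<close>. The part
    \<open>?c - ?m\<close> runs along the mirror and vanishes against \<open>n\<close>, so only
    \<open>2 * k\<close> survives.\<close>
  moreover have "2 *\<^sub>R X - Y - Y' = 2 *\<^sub>R (?c - ?m) + (2 * k) *\<^sub>R n"
  proof -
    have "2 *\<^sub>R X - Y - Y' = 2 *\<^sub>R (?c - ?m) + 2 *\<^sub>R (X - ?c)"
      by (simp add: Y' reflect_in_def algebra_simps scaleR_2)
    then show ?thesis by (simp add: k)
  qed
  ultimately have "((2 *\<^sub>R X - Y - Y') \<bullet> n) / (n \<bullet> n) = 2 * k"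
    using n0 by (simp add: inner_add_left del: inner_diff_left)
  moreover have "reflect_in t X = X - 2 *\<^sub>R (X - ?c)"
    by (simp add: reflect_in_def algebra_simps scaleR_2)
  ultimately show ?thesis by (simp add: k)
qed

lemma mem_line_through_iff: "Z \<in> line_through X Y \<longleftrightarrow> (\<exists>s. Z = X + s *\<^sub>R (Y - X))"
proof
  assume "Z \<in> line_through X Y"
  then obtain p q where Z: "Z = p *\<^sub>R X + q *\<^sub>R Y" and "p + q = 1"
    unfolding affine_hull_2 by blast
  then have p: "p = 1 - q" by simp
  have "Z = X + q *\<^sub>R (Y - X)" unfolding Z p by (simp add: algebra_simps)
  then show "\<exists>s. Z = X + s *\<^sub>R (Y - X)" ..
next
  assume "\<exists>s. Z = X + s *\<^sub>R (Y - X)"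
  then obtain s where "Z = X + s *\<^sub>R (Y - X)" ..
  then have "Z = (1 - s) *\<^sub>R X + s *\<^sub>R Y" by (simp add: algebra_simps)
  then show "Z \<in> line_through X Y"
    unfolding affine_hull_2 by (intro CollectI exI[of _ "1 - s"] exI[of _ s]) simp
qed

section \<open>Coordinates in an orthonormal frame of the plane\<close>

locale orthonormal_frame =
  fixes Z u v :: plane
  assumes norm_u: "norm u = 1" and norm_v: "norm v = 1" and orth: "u \<bullet> v = 0"
begin

definition pt :: "real \<Rightarrow> real \<Rightarrow> plane" where
  "pt x y = Z + x *\<^sub>R u + y *\<^sub>R v"

definition polar :: "real \<Rightarrow> real \<Rightarrow> plane" where
  "polar r \<phi> = pt (r * cos \<phi>) (r * sin \<phi>)"

lemma frame_inner [simp]: "u \<bullet> u = 1" "v \<bullet> v = 1" "u \<bullet> v = 0" "v \<bullet> u = 0"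
  using norm_u norm_v orth by (auto simp: norm_eq_sqrt_inner inner_commute)

lemma pt_diff: "pt x y - pt a b = (x - a) *\<^sub>R u + (y - b) *\<^sub>R v"
  by (simp add: pt_def algebra_simps)

lemma pt_inner:
  "(pt x y - pt a b) \<bullet> (pt x' y' - pt a' b') = (x - a) * (x' - a') + (y - b) * (y' - b')"
  unfolding pt_diff by (simp add: inner_add_left inner_add_right)

lemma norm_pt_diff: "norm (pt x y - pt a b) = sqrt ((x - a)\<^sup>2 + (y - b)\<^sup>2)"
  by (simp add: norm_eq_sqrt_inner pt_inner power2_eq_square)

lemma pt_eq_iff: "pt x y = pt a b \<longleftrightarrow> x = a \<and> y = b"
proof
  assume "pt x y = pt a b"
  then have "(x - a) *\<^sub>R u + (y - b) *\<^sub>R v = 0" by (metis pt_diff right_minus_eq)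
  then have "((x - a) *\<^sub>R u + (y - b) *\<^sub>R v) \<bullet> u = 0" "((x - a) *\<^sub>R u + (y - b) *\<^sub>R v) \<bullet> v = 0"
    by simp_all
  then show "x = a \<and> y = b" by (simp add: inner_add_left)
qed simp

lemma pt_along: "pt a b + s *\<^sub>R (pt c d - pt a b) = pt (a + s * (c - a)) (b + s * (d - b))"
  by (simp add: pt_def algebra_simps)

text \<open>Two orthonormal vectors span the plane: once its component along \<open>v\<close> is
  removed, a vector is orthogonal to \<open>v\<close>, as \<open>u\<close> is, and hence a multiple
  of \<open>u\<close>.\<close>

lemma ex_pt: "\<exists>x y. X = pt x y"
proof -
  have "v \<noteq> 0" using norm_v by auto
  have "u \<noteq> 0" using norm_u by auto
  let ?w = "X - Z - ((X - Z) \<bullet> v) *\<^sub>R v"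
  have "?w \<bullet> v = 0" by (simp add: inner_diff_left)
  then obtain k where "?w = k *\<^sub>R u"
    using orthogonal_same_imp_parallel[of v ?w u] \<open>v \<noteq> 0\<close> \<open>u \<noteq> 0\<close> orth by auto
  then have "X = pt k ((X - Z) \<bullet> v)" by (simp add: pt_def algebra_simps)
  then show ?thesis by blast
qed

lemma mem_line_through_pt_iff:
  "pt x y \<in> line_through (pt a b) (pt c d) \<longleftrightarrow> (\<exists>s. x = a + s * (c - a) \<and> y = b + s * (d - b))"
  by (simp add: mem_line_through_iff pt_along pt_eq_iff)

lemma mem_segment_pt_iff:
  "pt x y \<in> closed_segment (pt a b) (pt c d) \<longleftrightarrow>
    (\<exists>s. 0 \<le> s \<and> s \<le> 1 \<and> x = a + s * (c - a) \<and> y = b + s * (d - b))"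
proof -
  have "(1 - s) *\<^sub>R pt a b + s *\<^sub>R pt c d = pt (a + s * (c - a)) (b + s * (d - b))" for s
    by (simp add: pt_def algebra_simps)
  then show ?thesis by (auto simp: closed_segment_def pt_eq_iff)
qed

lemma horizontal_line_eq:
  assumes "a \<noteq> c"
  shows "line_through (pt a b) (pt c b) = {pt x b |x. True}"
proof -
  have "\<exists>s. x = a + s * (c - a)" for x
    using assms by (intro exI[of _ "(x - a) / (c - a)"]) simp
  then have "pt x y \<in> line_through (pt a b) (pt c b) \<longleftrightarrow> y = b" for x y
    by (simp add: mem_line_through_pt_iff)
  then have "Y \<in> line_through (pt a b) (pt c b) \<longleftrightarrow> Y \<in> {pt x b |x. True}" for Y
    using ex_pt[of Y] by (auto simp: pt_eq_iff)
  then show ?thesis by blast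
qed

text \<open>Some translation puts both points on one horizontal line, and it preserves their
  difference, whose component along \<open>v\<close> must therefore vanish.\<close>

lemma parallel_to_horizontal_line:
  assumes "affine_parallel (line_through (pt a b) (pt c d)) {pt x k |x. True}"
  shows "b = d"
proof -
  from assms obtain w where w: "{pt x k |x. True} = (\<lambda>x. w + x) ` line_through (pt a b) (pt c d)"
    unfolding affine_parallel_def by blast
  have "pt a b \<in> line_through (pt a b) (pt c d)" "pt c d \<in> line_through (pt a b) (pt c d)"
    by (simp_all add: hull_inc)
  then obtain x x' where "w + pt a b = pt x k" "w + pt c d = pt x' k"
    using w by blast
  then have "pt a b - pt c d = pt x k - pt x' k" by (metis add_diff_cancel_left)
  then have "(pt a b - pt c d) \<bullet> v = (pt x k - pt x' k) \<bullet> v" by simp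
  then show ?thesis by (simp add: pt_diff inner_add_left)
qed

lemma infdist_horizontal_line: "infdist (pt x y) {pt s k |s. True} = \<bar>y - k\<bar>"
proof (rule antisym)
  have "infdist (pt x y) {pt s k |s. True} \<le> dist (pt x y) (pt x k)"
    by (rule infdist_le) auto
  then show "infdist (pt x y) {pt s k |s. True} \<le> \<bar>y - k\<bar>"
    by (simp add: dist_norm norm_pt_diff)
  have "\<bar>y - k\<bar> \<le> dist (pt x y) (pt s k)" for s
    unfolding dist_norm norm_pt_diff
    by (metis real_sqrt_abs real_sqrt_le_mono le_add_same_cancel2 zero_le_power2)
  then show "\<bar>y - k\<bar> \<le> infdist (pt x y) {pt s k |s. True}"
    by (subst infdist_notempty) (auto intro!: cINF_greatest)
qed

section \<open>Polar coordinates, angles and the effect of the fold\<close>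

lemma ex_polar:
  assumes "0 \<le> x" and "0 \<le> y"
  shows "\<exists>r \<phi>. 0 \<le> r \<and> 0 \<le> \<phi> \<and> \<phi> \<le> pi / 2 \<and> pt x y = polar r \<phi>"
proof (cases "x = 0 \<and> y = 0")
  case True
  then show ?thesis by (intro exI[of _ 0]) (auto simp: polar_def)
next
  case False
  define r where "r = sqrt (x\<^sup>2 + y\<^sup>2)"
  have "0 < x\<^sup>2 + y\<^sup>2" using False by (simp add: sum_power2_gt_zero_iff)
  then have r: "0 < r" "r\<^sup>2 = x\<^sup>2 + y\<^sup>2" by (simp_all add: r_def)
  have "(x / r)\<^sup>2 + (y / r)\<^sup>2 = 1"
    using r(1) by (simp add: power_divide flip: add_divide_distrib r(2))
  then obtain \<phi> where \<phi>: "0 \<le> \<phi>" "\<phi> \<le> pi / 2" "x / r = cos \<phi>" "y / r = sin \<phi>"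
    using sincos_total_pi_half[of "x / r" "y / r"] assms r by auto
  then have "pt x y = polar r \<phi>" using r by (simp add: polar_def pt_eq_iff flip: \<phi>(3,4))
  then show ?thesis using \<phi> r by (intro exI[of _ r] exI[of _ \<phi>]) auto
qed

text \<open>The inner product yields the cosine of the difference of the arguments; the bounds place
  this difference where \<open>arccos\<close> inverts \<open>cos\<close>.\<close>

lemma angle_polar:
  assumes "0 < r" "0 < s" "0 \<le> \<psi> - \<phi>" "\<psi> - \<phi> \<le> pi"
  shows "angle (polar r \<phi>) (pt 0 0) (polar s \<psi>) = \<psi> - \<phi>"
proof -
  have nrm: "norm (polar q \<omega> - pt 0 0) = q" if "0 < q" for q \<omega>
  proof -
    have "(q * cos \<omega> - 0)\<^sup>2 + (q * sin \<omega> - 0)\<^sup>2 = q\<^sup>2"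
      by (simp add: power_mult_distrib flip: distrib_left)
    then show ?thesis unfolding polar_def norm_pt_diff using that by simp
  qed
  have "(polar r \<phi> - pt 0 0) \<bullet> (polar s \<psi> - pt 0 0) = r * s * cos (\<psi> - \<phi>)"
    unfolding polar_def pt_inner by (simp add: cos_diff algebra_simps)
  then have "angle (polar r \<phi>) (pt 0 0) (polar s \<psi>) = arccos (cos (\<psi> - \<phi>))"
    using assms unfolding angle_def by (simp add: nrm)
  then show ?thesis using assms by (simp add: arccos_cos)
qed

text \<open>With z for \<open>polar r \<theta>\<close>, the reflection exchanging 0 and z sends w to
  z - (z / conj z) * conj w. The point folded here is 2i Im z = z - conj z, so its image is z^2 /
  conj z = z^3 / |z|^2.\<close>

lemma fold_triples_angle:
  assumes t: "is_line t" and img: "reflect_in t (pt 0 0) = polar r \<theta>" and r: "0 < r"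
  shows "reflect_in t (pt 0 (2 * (r * sin \<theta>))) = polar r (3 * \<theta>)"
proof -
  let ?c = "cos \<theta>" and ?s = "sin \<theta>"
  let ?E = "pt 0 (2 * (r * ?s))" and ?n = "polar r \<theta> - pt 0 0"
  have cs: "?c\<^sup>2 = 1 - ?s\<^sup>2" by (simp add: cos_squared_eq)
  have nn: "?n \<bullet> ?n = r\<^sup>2"
    unfolding polar_def pt_inner by (simp add: power2_eq_square[symmetric] power_mult_distrib cs algebra_simps)
  \<comment> \<open>The vector is written as a sum of two differences of points, the shape to which
    \<open>pt_inner\<close> applies.\<close>
  have "(2 *\<^sub>R ?E - pt 0 0 - polar r \<theta>) \<bullet> ?n = (?E - pt 0 0) \<bullet> ?n + (?E - polar r \<theta>) \<bullet> ?n"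
    unfolding inner_add_left[symmetric] by (rule arg_cong[of _ _ "\<lambda>z. z \<bullet> ?n"]) (simp add: scaleR_2)
  also have "\<dots> = r\<^sup>2 * (3 * ?s\<^sup>2 - ?c\<^sup>2)"
    unfolding polar_def pt_inner by (simp add: power2_eq_square algebra_simps)
  finally have "((2 *\<^sub>R ?E - pt 0 0 - polar r \<theta>) \<bullet> ?n) / (?n \<bullet> ?n) = 3 * ?s\<^sup>2 - ?c\<^sup>2"
    using r by (simp add: nn)
  moreover have "polar r \<theta> \<noteq> pt 0 0" using nn r by auto
  ultimately have "reflect_in t ?E = ?E - (3 * ?s\<^sup>2 - ?c\<^sup>2) *\<^sub>R ?n"
    using reflect_in_from_image[OF t img[symmetric], of ?E] by simp
  also have "\<dots> = pt (- (3 * ?s\<^sup>2 - ?c\<^sup>2) * (r * ?c)) (2 * (r * ?s) - (3 * ?s\<^sup>2 - ?c\<^sup>2) * (r * ?s))"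
    by (simp add: polar_def pt_def algebra_simps)
  also have "\<dots> = polar r (3 * \<theta>)"
  proof -
    have "3 * \<theta> = \<theta> + 2 * \<theta>" by simp
    then have "cos (3 * \<theta>) = ?c * (?c\<^sup>2 - ?s\<^sup>2) - ?s * (2 * ?s * ?c)"
      "sin (3 * \<theta>) = ?s * (?c\<^sup>2 - ?s\<^sup>2) + ?c * (2 * ?s * ?c)"
      by (simp_all only: cos_add sin_add cos_double sin_double)
    \<comment> \<open>The factor \<open>?s\<^sup>2 + ?c\<^sup>2\<close> equals 1 but is kept for
      now: it makes both sides homogeneous cubics, so the identities are purely polynomial.\<close>
    then have "cos (3 * \<theta>) = - (3 * ?s\<^sup>2 - ?c\<^sup>2) * ?c"
      "sin (3 * \<theta>) = 2 * ?s * (?s\<^sup>2 + ?c\<^sup>2) - (3 * ?s\<^sup>2 - ?c\<^sup>2) * ?s"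
      by algebra+
    then show ?thesis
      unfolding polar_def pt_eq_iff
      by (simp only: sin_cos_squared_add mult_1_right) (simp add: algebra_simps)
  qed
  finally show ?thesis .
qed

text \<open>The triangle with base from the origin to \<open>polar r \<theta>\<close> and apex at
  the given point is isosceles. Apex and \<open>polar r \<theta>\<close> have the same height, so
  the base angles equal the alternate angle \<theta>, and the apex has argument
  \<open>2 * \<theta>\<close>. Its modulus is half the base divided by
  \<open>cos \<theta>\<close>.\<close>

lemma equidistant_doubles_angle:
  assumes eq: "dist (pt x (r * sin \<theta>)) (pt 0 0) = dist (pt x (r * sin \<theta>)) (polar r \<theta>)"
    and r: "0 < r" and "0 < \<theta>" "\<theta> < pi / 2"
  shows "pt x (r * sin \<theta>) = polar (r / (2 * cos \<theta>)) (2 * \<theta>)"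
proof -
  have c: "0 < cos \<theta>" using assms by (intro cos_gt_zero) auto
  have "x\<^sup>2 + (r * sin \<theta>)\<^sup>2 = (x - r * cos \<theta>)\<^sup>2"
    using eq unfolding dist_norm polar_def norm_pt_diff real_sqrt_eq_iff by simp
  then have "2 * x * (r * cos \<theta>) = r\<^sup>2 * cos (2 * \<theta>)"
    unfolding cos_double by (simp add: power2_eq_square algebra_simps)
  then have "x = r * cos (2 * \<theta>) / (2 * cos \<theta>)"
    using r c by (simp add: field_simps power2_eq_square)
  then show ?thesis
    using c by (simp add: polar_def pt_eq_iff sin_double)
qed

lemma polar_eqD:
  assumes eq: "polar r \<phi> = polar s \<psi>" and "0 < r" "0 < s" and "\<bar>\<phi> - \<psi>\<bar> < 2 * pi"
  shows "\<phi> = \<psi>"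
proof -
  have xy: "r * cos \<phi> = s * cos \<psi>" "r * sin \<phi> = s * sin \<psi>"
    using eq by (simp_all add: polar_def pt_eq_iff)
  have "r * sin (\<phi> - \<psi>) = (r * sin \<phi>) * cos \<psi> - (r * cos \<phi>) * sin \<psi>"
    by (simp add: sin_diff algebra_simps)
  also have "\<dots> = 0" by (simp add: xy)
  finally have sin: "sin (\<phi> - \<psi>) = 0" using assms by simp
  have "r * cos (\<phi> - \<psi>) = (r * cos \<phi>) * cos \<psi> + (r * sin \<phi>) * sin \<psi>"
    by (simp add: cos_diff algebra_simps)
  also have "\<dots> = s * ((cos \<psi>)\<^sup>2 + (sin \<psi>)\<^sup>2)"
    unfolding xy by (simp only: power2_eq_square distrib_left mult.assoc)
  \<comment> \<open>A vanishing sine still allows a half turn; the positive cosine excludes it and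
    leaves only whole turns, which the bound on the difference reduces to zero.\<close>
  finally have "0 < cos (\<phi> - \<psi>)"
    using assms by (simp add: zero_less_mult_iff) (metis zero_less_mult_pos)
  then have "cos (\<phi> - \<psi>) = 1"
    using sin sin_cos_squared_add[of "\<phi> - \<psi>"] by (simp add: power2_eq_1_iff)
  then obtain k :: int where k: "\<phi> - \<psi> = of_int k * (2 * pi)"
    by (auto simp: cos_one_2pi_int)
  then have "\<bar>of_int k\<bar> * (2 * pi) < 1 * (2 * pi)"
    using assms(4) by (simp add: abs_mult)
  then have "\<bar>real_of_int k\<bar> < 1" by (rule mult_right_less_imp_less) simp
  then have "k = 0" by linarith
  then show ?thesis using k by simp
qed

end

section \<open>From the folded rectangle to the trisection\<close>

lemma right_angle_imp_orthogonal:
  assumes "angle X Y Z = pi / 2"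
  shows "(X - Y) \<bullet> (Z - Y) = 0"
proof (cases "X = Y \<or> Z = Y")
  case False
  \<comment> \<open>By Cauchy-Schwarz this quotient lies in [-1, 1], where \<open>cos\<close> undoes
    \<open>arccos\<close>. In the degenerate case one vector is zero, and so is the inner
    product.\<close>
  let ?q = "((X - Y) \<bullet> (Z - Y)) / (norm (X - Y) * norm (Z - Y))"
  have "\<bar>(X - Y) \<bullet> (Z - Y)\<bar> \<le> norm (X - Y) * norm (Z - Y)"
    by (rule Cauchy_Schwarz_ineq2)
  then have "\<bar>?q\<bar> \<le> 1" using False by (simp add: abs_div divide_le_eq)
  then have "?q = cos (angle X Y Z)" by (simp add: angle_def cos_arccos_abs del: abs_divide)
  then show ?thesis using assms False by simp
qed auto

theorem mainTheorem5:
  fixes A B C D P E F G H B' E' I :: plane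
    and t :: "plane set"
    and \<alpha> :: real
  assumes "rectangle A B C D"
    and "P \<in> convex hull {A, B, C, D}"
    and "\<alpha> = angle C B P"
    and "0 < \<alpha>" and "\<alpha> < pi / 2"
    and "E \<in> closed_segment A B" and "F \<in> closed_segment C D"
    and "affine_parallel (line_through E F) (line_through B C)"
    and "line_through E F \<noteq> line_through B C"
    and "G \<in> closed_segment A B" and "H \<in> closed_segment C D"
    and "mid_parallel (line_through G H) (line_through B C) (line_through E F)"
    and "is_line t"
    and "B' = reflect_in t B" and "B' \<in> closed_segment G H"
    and "E' = reflect_in t E" and "E' \<in> closed_segment B P"
    and "t \<inter> line_through G H = {I}"
  shows "trisect_angle (ray B B') (ray B I) C B P"
proof -
  define w where "w = norm (C - B)"
  define a where "a = norm (A - B)"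
  define u where "u = (C - B) /\<^sub>R w"
  define v where "v = (A - B) /\<^sub>R a"
  have w: "0 < w" and a: "0 < a"
    using assms(1) by (auto simp: w_def a_def rectangle_def)
  have right: "(A - B) \<bullet> (C - B) = 0" "(B - C) \<bullet> (D - C) = 0" "(D - A) \<bullet> (B - A) = 0"
    using assms(1) by (auto simp: rectangle_def intro!: right_angle_imp_orthogonal)
  \<comment> \<open>With \<open>B\<close> itself as the origin, \<open>pt\<close> would contain \<open>B\<close>, and \<open>B = pt 0 0\<close> would loop as a rewrite rule.\<close>
  define Z where "Z = B"
  interpret orthonormal_frame Z u v
    using w a right(1) by unfold_locales (auto simp: u_def v_def w_def a_def inner_commute)
  have B: "B = pt 0 0" and C: "C = pt w 0" and A: "A = pt 0 a"
    unfolding pt_def using w a by (simp_all add: u_def v_def Z_def)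
  \<comment> \<open>The right angle at \<open>C\<close> forces the abscissa \<open>w\<close>, the
    one at \<open>A\<close> the height \<open>a\<close>.\<close>
  have D: "D = pt w a"
  proof -
    obtain x y where D: "D = pt x y" using ex_pt by blast
    then show ?thesis using right(2,3) w a unfolding A B C D pt_inner by (simp add: pt_eq_iff)
  qed
  have BC: "line_through B C = {pt x 0 |x. True}"
    unfolding B C using w by (intro horizontal_line_eq) simp

  obtain e where E: "E = pt 0 e" and e0: "0 \<le> e"
  proof -
    obtain x y where E: "E = pt x y" using ex_pt by blast
    then show ?thesis using assms(6) that a unfolding A B E mem_segment_pt_iff
      by (force simp: algebra_simps)
  qed
  obtain f where F: "F = pt w f"
    using assms(7) ex_pt[of F] unfolding C D by (auto simp: mem_segment_pt_iff)
  obtain g where G: "G = pt 0 g"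
    using assms(10) ex_pt[of G] unfolding A B by (auto simp: mem_segment_pt_iff)
  obtain h where H: "H = pt w h"
    using assms(11) ex_pt[of H] unfolding C D by (auto simp: mem_segment_pt_iff)
  have ef: "e = f"
    using assms(8) unfolding BC E F by (rule parallel_to_horizontal_line)
  have gh: "g = h"
    using assms(12) unfolding mid_parallel_def BC G H by (blast intro: parallel_to_horizontal_line)
  have EF: "line_through E F = {pt x e |x. True}"
    unfolding E F ef using w by (intro horizontal_line_eq) simp
  have GH: "line_through G H = {pt x g |x. True}"
    unfolding G H gh using w by (intro horizontal_line_eq) simp
  have "e \<noteq> 0" using assms(9) unfolding BC EF by auto
  \<comment> \<open>Being equally far from the heights 0 and \<open>e\<close> with
    \<open>e \<noteq> 0\<close> leaves only \<open>g = e / 2\<close>, so \<open>E\<close> has twice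
    the height of \<open>B'\<close>, as \<open>fold_triples_angle\<close> requires.\<close>
  moreover have "\<bar>g\<bar> = \<bar>g - e\<bar>"
  proof -
    have "pt 0 g \<in> line_through G H" unfolding GH by blast
    then have "infdist (pt 0 g) (line_through B C) = infdist (pt 0 g) (line_through E F)"
      using assms(12) unfolding mid_parallel_def by blast
    then show ?thesis unfolding BC EF infdist_horizontal_line by simp
  qed
  ultimately have e: "e = 2 * g" and g: "0 < g" using e0 by auto

  obtain p where p: "0 \<le> p" "B' = pt p g"
  proof -
    obtain x y where xy: "B' = pt x y" using ex_pt by blast
    then have "0 \<le> x" "y = g"
      using assms(15) w unfolding G H gh xy mem_segment_pt_iff by auto
    then show ?thesis using that xy by blast
  qed
  obtain r \<theta> where r0: "0 \<le> r" and \<theta>0: "0 \<le> \<theta>" and \<theta>: "\<theta> \<le> pi / 2" and B': "B' = polar r \<theta>"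
    using ex_polar[of p g] p g by auto
  have grs: "g = r * sin \<theta>" using p(2) B' by (simp add: polar_def pt_eq_iff)
  have r: "0 < r" using r0 grs g by (cases "r = 0") auto
  have \<theta>_pos: "0 < \<theta>" using \<theta>0 grs g by (cases "\<theta> = 0") auto
  have E': "E' = polar r (3 * \<theta>)"
    using fold_triples_angle[OF assms(13) _ r] assms(14,16) by (simp add: B B' E e grs)

  \<comment> \<open>An unoriented angle does not tell on which side of
    \<open>line_through B C\<close> the point \<open>P\<close> lies. Membership in the rectangle
    does, and this makes \<alpha> the argument of \<open>P\<close>.\<close>
  have P_quadrant: "\<exists>x y. 0 \<le> x \<and> 0 \<le> y \<and> P = pt x y"
  proof -
    have "convex hull {A, B, C, D} \<subseteq> {X. u \<bullet> Z \<le> u \<bullet> X} \<inter> {X. v \<bullet> Z \<le> v \<bullet> X}"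
      using w a by (intro hull_minimal convex_Int)
        (auto simp: A B C D pt_def inner_add_right convex_halfspace_ge)
    then have "u \<bullet> Z \<le> u \<bullet> P" "v \<bullet> Z \<le> v \<bullet> P" using assms(2) by auto
    moreover obtain x y where "P = pt x y" using ex_pt by blast
    ultimately show ?thesis by (auto simp: pt_def inner_add_right)
  qed
  then obtain q \<beta> where q0: "0 \<le> q" and \<beta>: "0 \<le> \<beta>" "\<beta> \<le> pi / 2" and P: "P = polar q \<beta>"
    using ex_polar by metis
  \<comment> \<open>For \<open>P = B\<close> the angle would take its default value
    \<open>pi / 2\<close>, which \<open>\<alpha> < pi / 2\<close> excludes.\<close>
  have q: "0 < q"
  proof (rule ccontr)
    assume "\<not> 0 < q"
    then have "P = B" using q0 by (simp add: P polar_def B)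
    then show False using assms(3,5) by (simp add: angle_def)
  qed
  have C_polar: "C = polar w 0" by (simp add: C polar_def)
  have \<alpha>: "angle C B P = \<beta>" unfolding C_polar B P using angle_polar[of w q \<beta> 0] w q \<beta> by simp

  obtain s where s: "0 \<le> s" "E' = B + s *\<^sub>R (P - B)"
    using assms(17) by (auto simp: closed_segment_def algebra_simps)
  have E'_polar: "polar r (3 * \<theta>) = polar (s * q) \<beta>"
    using s(2) unfolding E' P B by (simp add: polar_def pt_def algebra_simps)
  \<comment> \<open>The point \<open>E'\<close> has distance \<open>r > 0\<close> from
    \<open>B\<close>.\<close>
  have "s \<noteq> 0"
  proof
    assume "s = 0"
    with E'_polar have "r * cos (3 * \<theta>) = 0" "r * sin (3 * \<theta>) = 0"
      by (simp_all add: polar_def pt_eq_iff)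
    then show False using r sin_zero_norm_cos_one[of "3 * \<theta>"] by simp
  qed
  \<comment> \<open>Here \<open>3 * \<theta>\<close> is at most \<open>3 * pi / 2\<close> and
    \<beta> lies between 0 and \<open>pi / 2\<close>, so the two arguments of \<open>E'\<close>
    differ by less than a full turn and must coincide.\<close>
  moreover have "\<bar>3 * \<theta> - \<beta>\<bar> < 2 * pi"
    using \<beta> \<theta> \<theta>0 pi_gt_zero by linarith
  ultimately have \<beta>_eq: "3 * \<theta> = \<beta>"
    using polar_eqD[OF E'_polar r] s q by simp
  then have \<theta>_lt: "\<theta> < pi / 2" using \<beta> \<theta>_pos by linarith

  have I: "I \<in> t" "I \<in> line_through G H" using assms(18) by auto
  then obtain x where x: "I = pt x (r * sin \<theta>)" unfolding GH grs by auto
  \<comment> \<open>A point of the crease is equally far from \<open>B\<close> and from its image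
    \<open>B'\<close>.\<close>
  have "dist I B = dist I (polar r \<theta>)"
    using dist_reflect_in_eq[OF assms(13) I(1), of B] assms(14) B' by simp
  then have I_polar: "I = polar (r / (2 * cos \<theta>)) (2 * \<theta>)"
    unfolding x B using r \<theta>_pos \<theta>_lt by (intro equidistant_doubles_angle)
  define \<rho> where "\<rho> = r / (2 * cos \<theta>)"
  have \<rho>: "0 < \<rho>" using r \<theta>_pos \<theta>_lt by (simp add: \<rho>_def cos_gt_zero)
  have neq: "polar k \<phi> \<noteq> B" if "0 < k" for k \<phi>
    using that sin_zero_norm_cos_one[of \<phi>] by (auto simp: B polar_def pt_eq_iff)
  \<comment> \<open>The points \<open>C\<close>, \<open>B'\<close>, \<open>I\<close>,
    \<open>P\<close> have arguments 0, \<theta>, \<open>2 * \<theta>\<close> and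
    \<open>3 * \<theta> = \<beta>\<close>, so neighbouring ones enclose the angle \<theta> at
    \<open>B\<close>.\<close>
  have "angle C B B' = \<beta> / 3"
    unfolding C_polar B B' using angle_polar[of w r \<theta> 0] w r \<theta> \<theta>0 \<beta>_eq by simp
  moreover have "angle B' B I = \<beta> / 3"
    unfolding B B' I_polar using angle_polar[of r \<rho> "2 * \<theta>" \<theta>] r \<rho> \<theta> \<theta>0 \<beta>_eq by (simp add: \<rho>_def)
  moreover have "angle I B P = \<beta> / 3"
    unfolding B I_polar P using angle_polar[of \<rho> q \<beta> "2 * \<theta>"] q \<rho> \<theta> \<theta>0 \<beta>_eq by (simp add: \<rho>_def)
  moreover have "B' \<noteq> B" "I \<noteq> B" using neq r \<rho> by (simp_all add: B' I_polar \<rho>_def)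
  ultimately show ?thesis unfolding trisect_angle_def \<alpha> by blast
qed

end
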